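(* Let $n\ge 3$ and $k\ge 2$, and let $\pi\in\mathcal S_n(132,213)$ with $\kappa(\pi)=(a_1,a_2,\dots,a_k)$ and $a_1>a_k$. Let $r(\pi)\in\mathcal S_m(132,213)$ be the permutation whose composition is $$\kappa(r(\pi))=\begin{cases}(a_k,a_2,\dots,a_{k-1},2a_k-a_1), & 2a_k>a_1>a_k,\\ (a_1-2a_k,a_k,a_2,\dots,a_{k-1}), & a_1>2a_k,\\ (a_k,a_2,\dots,a_{k-1}), & a_1=2a_k,\end{cases}$$ where $m=n-2(a_1-a_k)$ in the first and third cases and $m=n-2a_k$ in the second case (so $m$ and $n$ have the same parity). Then $\pi\in\mathcal C_n(132,213)$ if and only if $r(\pi)\in\mathcal C_m(132,213)$.
   Context: $\mathcal S_n(132,213)$ is the set of permutations of $[n]=\{1,\dots,n\}$ which, in one-line notation, avoid the patterns $132$ and $213$. $\mathcal C_n(132,213)$ is the subset of those that are cyclic, i.e. whose cycle decomposition is a single cycle of length $n$. For $\sigma\in\mathcal S_p$ and $\tau\in\mathcal S_q$, the skew sum is $\sigma\ominus\tau=(\sigma_1+q)\cdots(\sigma_p+q)\,\tau_1\cdots\tau_q$, and $\mathrm{id}_a=12\cdots a$. Every $\pi\in\mathcal S_n(132,213)$ is uniquely of the form $\mathrm{id}_{a_1}\ominus\mathrm{id}_{a_2}\ominus\cdots\ominus\mathrm{id}_{a_k}$ with $(a_1,\dots,a_k)$ a composition of $n$ (a tuple of positive integers with sum $n$), and every composition of $n$ arises; write $\kappa(\pi)=(a_1,\dots,a_k)$.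 Convention: a segment $a_2,\dots,a_{k-1}$ is empty when $k=2$ and is the single entry $a_2$ when $k=3$. So for $k=2$ the three cases read $(a_2,2a_2-a_1)$, $(a_1-2a_2,a_2)$ and $(a_2)$. *)

theory Defs
  imports "HOL-Combinatorics.Permutations" "HOL-Combinatorics.Orbits" "HOL-Library.Sublist"
begin

text \<open>Permutations of \<open>[n]\<close> are functions \<^term>\<open>\<pi>\<close> with \<^prop>\<open>\<pi> permutes {1..n::nat}\<close>, hence the
  identity outside \<open>{1..n}\<close>.\<close>

definition one_line :: "nat \<Rightarrow> (nat \<Rightarrow> nat) \<Rightarrow> nat list" where
  "one_line n \<pi> = map \<pi> [1..<Suc n]"

definition order_iso :: "nat list \<Rightarrow> nat list \<Rightarrow> bool" where
  "order_iso xs ys \<longleftrightarrow> length xs = length ys \<and>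
     (\<forall>i<length xs. \<forall>j<length xs. xs ! i < xs ! j \<longleftrightarrow> ys ! i < ys ! j)"

definition contains_pattern :: "nat list \<Rightarrow> nat list \<Rightarrow> bool" where
  "contains_pattern w p \<longleftrightarrow> (\<exists>ys. subseq ys w \<and> order_iso ys p)"

definition S_av :: "nat \<Rightarrow> nat list set \<Rightarrow> (nat \<Rightarrow> nat) set" where
  "S_av n P = {\<pi>. \<pi> permutes {1..n} \<and> (\<forall>p\<in>P. \<not> contains_pattern (one_line n \<pi>) p)}"

definition C_av :: "nat \<Rightarrow> nat list set \<Rightarrow> (nat \<Rightarrow> nat) set" where
  "C_av n P = {\<pi> \<in> S_av n P. cyclic_on \<pi> {1..n}}"

abbreviation pats :: "nat list set" where
  "pats \<equiv> {[1, 3, 2], [2, 1, 3]}"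

text \<open>Skew sums are formed on one-line words.\<close>

definition skew_sum :: "nat list \<Rightarrow> nat list \<Rightarrow> nat list" (infixr "\<ominus>\<^sub>w" 65) where
  "\<sigma> \<ominus>\<^sub>w \<tau> = map (\<lambda>x. x + length \<tau>) \<sigma> @ \<tau>"

definition id_word :: "nat \<Rightarrow> nat list" where
  "id_word a = [1..<Suc a]"

definition skew_ids :: "nat list \<Rightarrow> nat list" where
  "skew_ids as = foldr (\<lambda>a w. id_word a \<ominus>\<^sub>w w) as []"

definition is_composition :: "nat \<Rightarrow> nat list \<Rightarrow> bool" where
  "is_composition n as \<longleftrightarrow> (\<forall>a\<in>set as. 0 < a) \<and> sum_list as = n"

text \<open>Meaningful for \<^prop>\<open>\<pi> \<in> S_av n pats\<close>; see \<open>kappa_unique\<close> and \<open>kappa_onto\<close> below.\<close>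

definition kappa :: "nat \<Rightarrow> (nat \<Rightarrow> nat) \<Rightarrow> nat list" where
  "kappa n \<pi> = (THE as. is_composition n as \<and> one_line n \<pi> = skew_ids as)"

text \<open>For compositions with at least two parts and first part larger than the last part, the only
  ones to which these functions are applied, no truncated subtraction occurs; the middle segment
  \<open>a\<^sub>2, \<dots>, a\<^sub>k\<^sub>-\<^sub>1\<close> is \<open>butlast (tl as)\<close>.\<close>

definition red_comp :: "nat list \<Rightarrow> nat list" where
  "red_comp as = (let x = hd as; y = last as; mid = butlast (tl as) in
     if 2 * y > x then y # mid @ [2 * y - x]
     else if x > 2 * y then (x - 2 * y) # y # mid
     else y # mid)"

definition red_size :: "nat \<Rightarrow> nat list \<Rightarrow> nat" where
  "red_size n as = (let x = hd as; y = last as in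
     if x > 2 * y then n - 2 * y else n - 2 * (x - y))"

definition red_perm :: "nat \<Rightarrow> (nat \<Rightarrow> nat) \<Rightarrow> (nat \<Rightarrow> nat)" where
  "red_perm n \<pi> = (let as = kappa n \<pi>; m = red_size n as in
     THE \<rho>. \<rho> \<in> S_av m pats \<and> kappa m \<rho> = red_comp as)"

lemma skew_ids_Nil [simp]: "skew_ids [] = []"
  by (simp add: skew_ids_def)

lemma skew_ids_Cons:
  "skew_ids (a # as) = map (\<lambda>x. x + length (skew_ids as)) [1..<Suc a] @ skew_ids as"
  by (simp add: skew_ids_def skew_sum_def id_word_def)

lemma length_skew_ids [simp]: "length (skew_ids as) = sum_list as"
  by (induction as) (simp_all add: skew_ids_Cons del: upt_Suc)

lemma map_add_upt': "map (\<lambda>x. x + b) [1..<Suc a] = [b + 1..<Suc (a + b)]"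
  using map_add_upt[of b "Suc a - 1"] 
  by (intro nth_equalityI) (auto simp: nth_append simp del: upt_Suc)

lemma skew_ids_Cons':
  "skew_ids (a # as) = [sum_list as + 1..<Suc (a + sum_list as)] @ skew_ids as"
  unfolding skew_ids_Cons map_add_upt' by simp

lemma set_skew_ids: "set (skew_ids as) = {1..sum_list as}"
  by (induction as) (auto simp: skew_ids_Cons' simp del: upt_Suc)

lemma distinct_skew_ids: "distinct (skew_ids as)"
  by (induction as) (auto simp: skew_ids_Cons' set_skew_ids simp del: upt_Suc)

lemma skew_ids_inj:
  assumes "skew_ids as = skew_ids bs" "\<forall>a\<in>set as. 0 < a" "\<forall>b\<in>set bs. 0 < b"
  shows "as = bs"
  using assms
proof (induction as arbitrary: bs)
  case Nil
  then show ?case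
    by (cases bs) (auto simp: skew_ids_Cons' simp del: upt_Suc)
next
  case (Cons a as)
  then obtain b cs where bs: "bs = b # cs"
    by (cases bs) (auto simp: skew_ids_Cons' simp del: upt_Suc)
  have len: "a + sum_list as = b + sum_list cs"
    using arg_cong[OF Cons.prems(1), of length] by (simp add: bs)
  have "hd (skew_ids (a # as)) = sum_list as + 1" "hd (skew_ids (b # cs)) = sum_list cs + 1"
    using Cons.prems(2,3) by (auto simp: skew_ids_Cons' bs upt_conv_Cons simp del: upt_Suc)
  then have s: "sum_list as = sum_list cs"
    using Cons.prems(1) bs by simp
  then have "a = b" using len by simp
  moreover have "skew_ids as = skew_ids cs"
    using Cons.prems(1) s \<open>a = b\<close> unfolding bs skew_ids_Cons' by (metis same_append_eq)
  ultimately have "a = b" "skew_ids as = skew_ids cs" by blast+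
  then show ?case
    using Cons.IH[of cs] Cons.prems(2,3) unfolding bs by (metis list.set_intros(2))
qed

lemma all_less_3: "(\<forall>i<3. P i) \<longleftrightarrow> P 0 \<and> P 1 \<and> P (2::nat)"
proof -
  have "i < 3 \<longleftrightarrow> i = 0 \<or> i = 1 \<or> i = (2::nat)" for i by linarith
  then show ?thesis by (simp only: ) blast
qed

lemma order_iso_length3:
  "order_iso ys [a, b, c] \<longleftrightarrow> (\<exists>x y z. ys = [x, y, z] \<and> order_iso [x, y, z] [a, b, c])"
proof
  assume o: "order_iso ys [a, b, c]"
  then have "length ys = Suc (Suc (Suc 0))" by (simp add: order_iso_def)
  then obtain x y z where "ys = [x, y, z]" by (auto simp: length_Suc_conv)
  with o show "\<exists>x y z. ys = [x, y, z] \<and> order_iso [x, y, z] [a, b, c]" by blast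
qed blast

lemma order_iso_3:
  "order_iso [x, y, z] [1, 3, 2] \<longleftrightarrow> x < z \<and> z < y"
  "order_iso [x, y, z] [2, 1, 3] \<longleftrightarrow> y < x \<and> x < z"
proof -
  have l: "length [x, y, z] = 3" by simp
  show "order_iso [x, y, z] [1, 3, 2] \<longleftrightarrow> x < z \<and> z < y"
    "order_iso [x, y, z] [2, 1, 3] \<longleftrightarrow> y < x \<and> x < z"
    unfolding order_iso_def l all_less_3 by simp_all linarith+
qed

lemma order_iso_pats:
  "order_iso ys [1, 3, 2] \<longleftrightarrow> (\<exists>x y z. ys = [x, y, z] \<and> x < z \<and> z < y)"
  "order_iso ys [2, 1, 3] \<longleftrightarrow> (\<exists>x y z. ys = [x, y, z] \<and> y < x \<and> x < z)"
  unfolding order_iso_length3[of ys] order_iso_3 by (rule refl)+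

lemma contains_pats:
  "(\<forall>p\<in>pats. \<not> contains_pattern w p) \<longleftrightarrow>
     (\<forall>x y z. subseq [x, y, z] w \<longrightarrow> \<not> (x < z \<and> z < y) \<and> \<not> (y < x \<and> x < z))"
proof -
  have "contains_pattern w [1, 3, 2] \<longleftrightarrow> (\<exists>x y z. subseq [x, y, z] w \<and> x < z \<and> z < y)"
    "contains_pattern w [2, 1, 3] \<longleftrightarrow> (\<exists>x y z. subseq [x, y, z] w \<and> y < x \<and> x < z)"
    unfolding contains_pattern_def order_iso_pats by blast+
  then show ?thesis by (simp only: ball_simps) blast
qed

lemma subseq_set: "subseq xs ys \<Longrightarrow> set xs \<subseteq> set ys"
  by (induction rule: list_emb.induct) auto

lemma subseq_strict_sorted:
  assumes "subseq xs ys" "sorted_wrt (<) ys"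
  shows "sorted_wrt (<) (xs :: nat list)"
  using assms
proof (induction rule: list_emb.induct)
  case (list_emb_Cons2 x y xs ys)
  then show ?case using subseq_set[of xs ys] by (simp add: subset_iff)
qed simp_all

lemma append_eq_3:
  assumes "[x, y, z] = u @ v"
  shows "u = [] \<and> v = [x, y, z] \<or> u = [x] \<and> v = [y, z] \<or> u = [x, y] \<and> v = [z] \<or>
    u = [x, y, z] \<and> v = []"
proof -
  have "length u \<le> 3" using arg_cong[OF assms, of length] by simp
  then consider "length u = 0" | "length u = 1" | "length u = 2" | "length u = 3"
    by linarith
  then show ?thesis
    using arg_cong[OF assms, of "take (length u)"] arg_cong[OF assms, of "drop (length u)"]
    by cases simp_all
qed

lemma skew_ids_avoids:
  "subseq [x, y, z] (skew_ids as) \<Longrightarrow> \<not> (x < z \<and> z < y) \<and> \<not> (y < x \<and> x < z)"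
proof (induction as)
  case Nil
  then show ?case by simp
next
  case (Cons a as)
  let ?u = "[sum_list as + 1..<Suc (a + sum_list as)]" and ?v = "skew_ids as"
  obtain xs1 xs2 where s: "[x, y, z] = xs1 @ xs2" "subseq xs1 ?u" "subseq xs2 ?v"
    using Cons.prems unfolding skew_ids_Cons' subseq_append_iff by blast
  have 1: "\<forall>x\<in>set xs1. x > sum_list as" and 2: "\<forall>x\<in>set xs2. x \<le> sum_list as"
    using subseq_set[OF s(2)] subseq_set[OF s(3)] by (auto simp: set_skew_ids simp del: upt_Suc)
  have 3: "sorted_wrt (<) xs1"
    by (rule subseq_strict_sorted[OF s(2)]) (rule sorted_wrt_upt)
  consider "xs1 = []" "xs2 = [x,y,z]" | "xs1 = [x]" "xs2 = [y,z]" | "xs1 = [x,y]" "xs2 = [z]"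
    | "xs1 = [x,y,z]" "xs2 = []"
    using append_eq_3[OF s(1)] by blast
  then show ?case
    using Cons.IH 1 2 3 s(3) by cases auto
qed

lemma skew_ids_exists:
  assumes "distinct w" "set w = {1..length w}" "\<forall>p\<in>pats. \<not> contains_pattern w p"
  shows "\<exists>as. (\<forall>a\<in>set as. 0 < a) \<and> w = skew_ids as"
  using assms
proof (induction "length w" arbitrary: w rule: less_induct)
  case less
  show ?case
  proof (cases w)
    case Nil
    then show ?thesis by (intro exI[of _ "[]"]) auto
  next
    case (Cons c v)
    define u where "u = takeWhile (\<lambda>x. c \<le> x) w"
    define r where "r = dropWhile (\<lambda>x. c \<le> x) w"
    have w: "w = u @ r" by (simp add: u_def r_def)
    obtain u' where u': "u = c # u'" by (simp add: u_def Cons)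
    have av: "\<not> (x < z \<and> z < y) \<and> \<not> (y < x \<and> x < z)" if "subseq [x, y, z] w" for x y z
      using less.prems(3) that unfolding contains_pats by blast
    have uge: "\<forall>x\<in>set u. c \<le> x" by (auto simp: u_def dest: set_takeWhileD)
    have rless: "\<forall>x\<in>set r. x < c"
    proof
      fix d assume d: "d \<in> set r"
      then obtain b r' where r: "r = b # r'" by (cases r) auto
      have b: "b < c"
        using r unfolding r_def dropWhile_eq_Cons_conv by simp
      show "d < c"
      proof (rule ccontr)
        assume "\<not> d < c"
        moreover have "d \<noteq> c" using less.prems(1) d by (auto simp: w u')
        ultimately have "c < d" by simp
        with b d r have "subseq [d] r'" by (auto simp: subseq_singleton_left)
        then have "subseq [c, b, d] (c # u' @ b # r')"
          using list_emb_append2[of "(=)" "[b,d]" "b # r'" u'] by simp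
        then show False using av[of c b d] b \<open>c < d\<close> by (simp add: w u' r)
      qed
    qed
    have sw: "sorted_wrt (<) u"
    proof -
      have "sorted_wrt (<) u'"
        unfolding sorted_wrt_iff_nth_less
      proof (intro allI impI)
        fix i j assume ij: "i < j" "j < length u'"
        have "subseq [u' ! i, u' ! j] u'"
        proof -
          have e: "u' = take j u' @ u' ! j # drop (Suc j) u'"
            using ij by (simp add: id_take_nth_drop)
          have "u' ! i \<in> set (take j u')" using ij by (auto simp: in_set_conv_nth)
          then have "subseq ([u' ! i] @ [u' ! j]) (take j u' @ u' ! j # drop (Suc j) u')"
            by (intro list_emb_append_mono) (auto simp: subseq_singleton_left)
          then show ?thesis using e by simp
        qed
        then have "subseq [c, u' ! i, u' ! j] w"
          unfolding w u' by (intro subseq_rev_drop_many) simp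
        moreover have "c < u' ! j" "u' ! i \<noteq> u' ! j"
        proof -
          have "u' ! j \<in> set u'" using ij by simp
          then show "c < u' ! j"
            using uge less.prems(1) by (auto simp: w u' intro: le_neq_trans)
          show "u' ! i \<noteq> u' ! j"
            using less.prems(1) ij by (simp add: w u' nth_eq_iff_index_eq)
        qed
        ultimately show "u' ! i < u' ! j" using av by (meson linorder_neqE_nat)
      qed
      moreover have "\<forall>x\<in>set u'. c < x"
        using uge less.prems(1) by (auto simp: w u' intro: le_neq_trans)
      ultimately show ?thesis by (simp add: u')
    qed
    have su: "set u = {c..length w}" and sr: "set r = {1..c - 1}"
    proof -
      have un: "set u \<union> set r = {1..length w}" using less.prems(2) w by simp
      have c: "1 \<le> c" "c \<le> length w" using less.prems(2) Cons by auto
      have "x \<in> set u \<longleftrightarrow> c \<le> x \<and> x \<le> length w" "x \<in> set r \<longleftrightarrow> 1 \<le> x \<and> x \<le> c - 1" for x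
      proof -
        have 1: "x \<in> set u \<Longrightarrow> c \<le> x" "x \<in> set r \<Longrightarrow> x < c" using uge rless by blast+
        have 2: "x \<in> set u \<or> x \<in> set r \<longleftrightarrow> 1 \<le> x \<and> x \<le> length w"
          using un unfolding set_eq_iff Un_iff atLeastAtMost_iff by blast
        show "x \<in> set u \<longleftrightarrow> c \<le> x \<and> x \<le> length w" "x \<in> set r \<longleftrightarrow> 1 \<le> x \<and> x \<le> c - 1"
          using 1 2 c by linarith+
      qed
      then show "set u = {c..length w}" "set r = {1..c - 1}"
        unfolding set_eq_iff atLeastAtMost_iff by blast+
    qed
    have dr: "distinct r" using less.prems(1) by (simp add: w)
    have lr: "length r = c - 1" using distinct_card[OF dr] sr by simp
    have lrw: "length r < length w" by (simp add: w u')
    have rav: "\<forall>p\<in>pats. \<not> contains_pattern r p"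
      using less.prems(3) unfolding contains_pattern_def w by (meson subseq_drop_many)
    have "set r = {1..length r}" using sr lr by simp
    from less.hyps[OF lrw dr this rav]
    obtain as where as: "\<forall>a\<in>set as. 0 < a" "r = skew_ids as" by blast
    have "c \<in> set w" by (simp add: Cons)
    then have c: "1 \<le> c" "c \<le> length w" unfolding less.prems(2) by simp_all
    have "set u = set [c..<Suc (length w)]" unfolding su by (simp del: upt_Suc add: atLeastLessThanSuc_atLeastAtMost)
    from strict_sorted_equal[OF sorted_wrt_upt sw this]
    have u: "u = [c..<Suc (length w)]" .
    have sum: "sum_list as = c - 1" using lr unfolding as(2) by simp
    define a where "a = length w - (c - 1)"
    have a: "0 < a" "sum_list as + 1 = c" "a + sum_list as = length w"
      using c sum by (simp_all add: a_def)
    have "skew_ids (a # as) = u @ r"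
      unfolding skew_ids_Cons' a u as(2)[symmetric] ..
    then have "w = skew_ids (a # as)" unfolding w ..
    moreover have "\<forall>b\<in>set (a # as). 0 < b" using as(1) a(1) by simp
    ultimately show ?thesis by blast
  qed
qed

lemma length_one_line [simp]: "length (one_line n \<pi>) = n"
  by (simp add: one_line_def del: upt_Suc)

lemma one_line_inj:
  assumes "\<pi> permutes {1..n}" "\<rho> permutes {1..n}" "one_line n \<pi> = one_line n \<rho>"
  shows "\<pi> = \<rho>"
proof
  fix i
  show "\<pi> i = \<rho> i"
  proof (cases "i \<in> {1..n}")
    case True
    then show ?thesis using assms(3) by (auto simp: one_line_def simp del: upt_Suc)
  next
    case False
    then show ?thesis using assms(1,2) by (metis permutes_not_in)
  qed
qed

theorem kappa_unique:
  assumes "\<pi> \<in> S_av n pats"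
  shows "\<exists>!as. is_composition n as \<and> one_line n \<pi> = skew_ids as"
proof -
  have p: "\<pi> permutes {1..n}" and av: "\<forall>p\<in>pats. \<not> contains_pattern (one_line n \<pi>) p"
    using assms by (auto simp: S_av_def)
  have d: "distinct (one_line n \<pi>)"
    using permutes_inj[OF p] by (auto simp: one_line_def distinct_map inj_on_def inj_def simp del: upt_Suc)
  have "set (one_line n \<pi>) = \<pi> ` {1..n}" by (auto simp: one_line_def simp del: upt_Suc)
  then have s: "set (one_line n \<pi>) = {1..length (one_line n \<pi>)}"
    using permutes_image[OF p] by simp
  obtain as where as: "\<forall>a\<in>set as. 0 < a" "one_line n \<pi> = skew_ids as"
    using skew_ids_exists[OF d s av] by blast
  have "sum_list as = n" using arg_cong[OF as(2), of length] by simp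
  with as have "is_composition n as \<and> one_line n \<pi> = skew_ids as"
    by (simp add: is_composition_def)
  moreover have "bs = as" if "is_composition n bs \<and> one_line n \<pi> = skew_ids bs" for bs
    using skew_ids_inj[of bs as] that as unfolding is_composition_def by argo
  ultimately show ?thesis by blast
qed

lemma kappa_eq_iff:
  assumes "\<pi> \<in> S_av n pats"
  shows "kappa n \<pi> = as \<longleftrightarrow> is_composition n as \<and> one_line n \<pi> = skew_ids as"
  using theI'[OF kappa_unique[OF assms]] kappa_unique[OF assms]
  unfolding kappa_def[symmetric] by blast

theorem kappa_onto:
  assumes "is_composition n as"
  shows "\<exists>!\<pi>. \<pi> \<in> S_av n pats \<and> kappa n \<pi> = as"
proof -
  define w where "w = skew_ids as"
  define \<pi> where "\<pi> i = (if i \<in> {1..n} then w ! (i - 1) else i)" for i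
  have lw: "length w = n" using assms by (simp add: w_def is_composition_def)
  have ol: "one_line n \<pi> = w"
    by (rule nth_equalityI) (auto simp: one_line_def lw \<pi>_def simp del: upt_Suc)
  have "\<pi> ` {1..n} = set (one_line n \<pi>)" by (auto simp: one_line_def simp del: upt_Suc)
  also have "\<dots> = {1..n}"
    using assms unfolding ol by (simp add: w_def set_skew_ids is_composition_def)
  finally have im: "\<pi> ` {1..n} = {1..n}" .
  then have "inj_on \<pi> {1..n}" by (simp add: eq_card_imp_inj_on)
  with im have "bij_betw \<pi> {1..n} {1..n}" by (simp add: bij_betw_def)
  then have p: "\<pi> permutes {1..n}"
    by (rule bij_imp_permutes) (unfold \<pi>_def, rule if_not_P)
  have "\<pi> \<in> S_av n pats"
    unfolding S_av_def mem_Collect_eq contains_pats ol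
    using p skew_ids_avoids unfolding w_def by blast
  moreover from this have "kappa n \<pi> = as"
    using assms ol by (simp add: kappa_eq_iff w_def)
  moreover have "\<rho> = \<pi>" if "\<rho> \<in> S_av n pats \<and> kappa n \<rho> = as" for \<rho>
    using that ol kappa_eq_iff[of \<rho> n as] p by (auto simp: S_av_def w_def intro: one_line_inj)
  ultimately show ?thesis by blast
qed

text \<open>Hence \<^const>\<open>red_perm\<close> is well defined whenever it is used.\<close>

lemma red_comp_composition:
  assumes "is_composition n as" "length as \<ge> 2" "hd as > last as"
  shows "is_composition (red_size n as) (red_comp as)"
proof -
  obtain x mid y where as: "as = x # mid @ [y]"
    using assms(2) by (cases as; cases "tl as" rule: rev_cases) auto
  show ?thesis
    using assms unfolding as
    by (auto simp: is_composition_def red_size_def red_comp_def Let_def)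
qed

theorem red_perm_spec:
  assumes "\<pi> \<in> S_av n pats" "length (kappa n \<pi>) \<ge> 2" "hd (kappa n \<pi>) > last (kappa n \<pi>)"
  shows "red_perm n \<pi> \<in> S_av (red_size n (kappa n \<pi>)) pats"
    and "kappa (red_size n (kappa n \<pi>)) (red_perm n \<pi>) = red_comp (kappa n \<pi>)"
proof -
  have "is_composition n (kappa n \<pi>)" using kappa_eq_iff[OF assms(1)] by blast
  from theI'[OF kappa_onto[OF red_comp_composition[OF this assms(2,3)]]]
  show "red_perm n \<pi> \<in> S_av (red_size n (kappa n \<pi>)) pats"
    and "kappa (red_size n (kappa n \<pi>)) (red_perm n \<pi>) = red_comp (kappa n \<pi>)"
    by (simp_all add: red_perm_def Let_def)
qed

end

theory Submission
  imports Defs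
begin

text \<open>
  The permutation \<open>\<pi>\<close> with composition \<open>(a, a\<^sub>2, \<dots>, a\<^sub>k\<^sub>-\<^sub>1, b)\<close> is a discrete interval
  exchange: it cuts \<open>{1..n}\<close> into intervals of these lengths and puts them back, by translations,
  in the reverse order. The reduction is then an instance of Rauzy induction, that is, of passing
  to first-return maps on shorter intervals. This preserves cyclicity in both directions
  (\<open>cyclic_on_first_return\<close>) as long as the removed set holds no two consecutive points of an orbit.

  Let \<open>a > b\<close> and \<open>d = a - b\<close>. The last interval is the image of the final \<open>b\<close> points of the first
  one and is carried to \<open>{1..b}\<close>. Removing it leaves a map that exchanges an initial interval \<open>D\<close> of
  length \<open>d\<close>, then an interval \<open>B\<close> of length \<open>b\<close>, then the middle intervals: \<open>B\<close> goes to the front,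
  \<open>D\<close> goes to the end, and the middle is reversed in between
  (\<open>exchange_word d b\<close>; \<open>cyclic_remove_last_block\<close>). The next removal is at the left end.

  If \<open>b \<le> d\<close>, remove \<open>{1..b}\<close>. Then \<open>B\<close> follows the initial part of \<open>D\<close> to the right end, and
  the result is the symmetric exchange with composition \<open>(d - b, b, a\<^sub>2, \<dots>, a\<^sub>k\<^sub>-\<^sub>1)\<close>, where
  \<open>d - b = a - 2b\<close>. Its first part disappears when \<open>a = 2b\<close>
  (\<open>cyclic_exchange_cut_short\<close>).

  If \<open>d < b\<close>, remove \<open>D\<close>. The first \<open>d\<close> points of \<open>B\<close> take over the role of \<open>D\<close>, and the result is
  \<open>exchange_word d (b - d)\<close> (\<open>cyclic_exchange_cut_long\<close>). The reduced composition
  \<open>(b, a\<^sub>2, \<dots>, a\<^sub>k\<^sub>-\<^sub>1, b - d)\<close> has the same difference \<open>d\<close> between its outer parts, so removing its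
  last interval leads to the very same map. In this case \<open>\<pi>\<close> and \<open>r(\<pi>)\<close> are compared
  through an induced map that they have in common.
\<close>

section \<open>First returns and cyclicity\<close>

text \<open>
  This is the return map to the complement of \<open>X\<close> when \<open>f\<close> never stays in \<open>X\<close> for two consecutive
  steps, so that a single extra application suffices.
\<close>

definition first_return :: "'a set \<Rightarrow> ('a \<Rightarrow> 'a) \<Rightarrow> 'a \<Rightarrow> 'a" where
  "first_return X f y = (if f y \<in> X then f (f y) else f y)"

lemma orbit_first_return:
  assumes no_stay: "f ` X \<inter> X = {}" and y: "y \<notin> X"
  shows "orbit (first_return X f) y = orbit f y - X"
proof (intro equalityI subsetI)
  fix z assume "z \<in> orbit (first_return X f) y"
  then show "z \<in> orbit f y - X"
    by induction (use no_stay in \<open>auto simp: first_return_def intro: orbit.intros\<close>)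
next
  fix z assume z: "z \<in> orbit f y - X"
  let ?O = "orbit (first_return X f) y"
  \<comment> \<open>Points of the orbit inside \<open>X\<close> are tracked through their predecessor, which is \<open>y\<close> or
    a point visited by the return map.\<close>
  have "if z \<in> X then \<exists>u \<in> insert y ?O. z = f u else z \<in> ?O" if "z \<in> orbit f y" for z
    using that
  proof induction
    case base
    have "first_return X f y = f y" if "f y \<notin> X" using that by (simp add: first_return_def)
    then show ?case using orbit.base[of "first_return X f" y] by auto
  next
    case (step z)
    show ?case
    proof (cases "z \<in> X")
      case True
      with step.IH obtain u where u: "u \<in> insert y ?O" "z = f u" by auto
      have "first_return X f u = f z" using True u by (simp add: first_return_def)
      then have "f z \<in> ?O"
        using u orbit.base[of "first_return X f" y] orbit.step[of u "first_return X f" y] by auto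
      then show ?thesis using no_stay True by auto
    next
      case False
      with step.IH have z: "z \<in> ?O" by simp
      have "first_return X f z = f z" if "f z \<notin> X" using that by (simp add: first_return_def)
      with orbit.step[OF z] z show ?thesis by auto
    qed
  qed
  from this[of z] z show "z \<in> ?O" by simp
qed

text \<open>
  The return map visits the points of an orbit outside \<open>X\<close> in the same cyclic order. In the converse
  direction the orbit must also recover \<open>X\<close>: by surjectivity each point of \<open>X\<close> is an image, and
  its preimage lies outside \<open>X\<close>, hence on the cycle of the return map.
\<close>

lemma cyclic_on_first_return:
  assumes img: "f ` S = S" and X: "X \<subset> S" and no_stay: "f ` X \<inter> X = {}"
  shows "cyclic_on f S \<longleftrightarrow> cyclic_on (first_return X f) (S - X)"
proof -
  obtain y where y: "y \<in> S" "y \<notin> X" using X by blast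
  note orb = orbit_first_return[OF no_stay y(2)]
  show ?thesis
  proof
    assume "cyclic_on f S"
    with y have "orbit f y = S" by (simp add: orbit_cyclic_eq3)
    with y orb show "cyclic_on (first_return X f) (S - X)"
      unfolding cyclic_on_def by blast
  next
    assume "cyclic_on (first_return X f) (S - X)"
    with y have "orbit (first_return X f) y = S - X" by (simp add: orbit_cyclic_eq3)
    with orb have rest: "S - X \<subseteq> orbit f y" by blast
    have "X \<subseteq> f ` (S - X)" using img X no_stay by blast
    with rest have "X \<subseteq> orbit f y" by (auto intro: orbit.step)
    moreover have "orbit f y \<subseteq> S"
    proof
      fix z assume "z \<in> orbit f y"
      then show "z \<in> S" by induction (use img y in auto)
    qed
    ultimately have "S = orbit f y" using rest by blast
    with y show "cyclic_on f S" unfolding cyclic_on_def by blast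
  qed
qed

section \<open>Words as maps\<close>

definition word_map :: "nat list \<Rightarrow> nat \<Rightarrow> nat" where
  "word_map w i = w ! (i - 1)"

definition cyclic_word :: "nat list \<Rightarrow> bool" where
  "cyclic_word w \<longleftrightarrow> cyclic_on (word_map w) {1..length w}"

lemma word_map_image: "word_map w ` {1..length w} = set w"
proof -
  have "{1..length w} = Suc ` {..<length w}" by (simp add: image_Suc_lessThan)
  then show ?thesis by (auto simp: word_map_def image_image set_conv_nth)
qed

lemma cyclic_one_line: "cyclic_on \<pi> {1..n} \<longleftrightarrow> cyclic_word (one_line n \<pi>)"
  unfolding cyclic_word_def length_one_line
  by (rule cyclic_cong) (auto simp: word_map_def one_line_def simp del: upt_Suc)

text \<open>
  The form in which the return argument is applied: \<open>c\<close> positions at the left end and \<open>e\<close> positions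
  at the right end of \<open>w\<close> are removed, and the return map on the remaining interval is the map of
  \<open>v\<close> translated by \<open>c\<close>.
\<close>

lemma cyclic_word_first_return:
  assumes w: "set w = {1..length w}" and v: "v \<noteq> []"
    and len: "length w = c + length v + e"
    and X: "X = {1..c} \<union> {c + length v + 1..length w}"
    and no_stay: "\<And>x. x \<in> X \<Longrightarrow> word_map w x \<notin> X"
    and ret: "\<And>i. i \<in> {1..length v} \<Longrightarrow>
      first_return X (word_map w) (c + i) = c + word_map v i"
  shows "cyclic_word w \<longleftrightarrow> cyclic_word v"
proof -
  let ?f = "word_map w" and ?g = "word_map v"
  let ?r = "first_return X ?f" and ?T = "{1..length v}"
  have rest: "{1..length w} - X = (\<lambda>i. c + i) ` ?T"
    unfolding X len image_add_atLeastAtMost by auto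
  have "c + 1 \<in> {1..length w} - X" using v unfolding X len by (cases v) auto
  moreover have "X \<subseteq> {1..length w}" unfolding X len by auto
  ultimately have "X \<subset> {1..length w}" by blast
  moreover have "?f ` X \<inter> X = {}" using no_stay by blast
  ultimately have "cyclic_word w \<longleftrightarrow> cyclic_on ?r ((\<lambda>i. c + i) ` ?T)"
    unfolding cyclic_word_def rest[symmetric]
    by (intro cyclic_on_first_return) (simp_all only: word_map_image w)
  also have "\<dots> \<longleftrightarrow> cyclic_on ?g ?T"
  proof
    assume "cyclic_on ?g ?T"
    then show "cyclic_on ?r ((\<lambda>i. c + i) ` ?T)"
      by (rule cyclic_on_image) (rule ret)
  next
    assume "cyclic_on ?r ((\<lambda>i. c + i) ` ?T)"
    then have "cyclic_on ?g ((\<lambda>x. x - c) ` (\<lambda>i. c + i) ` ?T)"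
      by (rule cyclic_on_image) (auto simp only: image_iff ret diff_add_inverse)
    then show "cyclic_on ?g ?T" by (simp only: image_image diff_add_inverse image_ident)
  qed
  finally show ?thesis by (simp add: cyclic_word_def)
qed

section \<open>Removing the last block\<close>

lemma skew_ids_append:
  "skew_ids (as @ bs) = map (\<lambda>x. x + sum_list bs) (skew_ids as) @ skew_ids bs"
  by (induction as) (simp_all add: skew_ids_Cons add.assoc del: upt_Suc)

lemma skew_ids_zero: "skew_ids (0 # as) = skew_ids as"
  by (simp add: skew_ids_Cons')

lemma skew_ids_nth_bounds:
  assumes "i < sum_list as"
  shows "1 \<le> skew_ids as ! i" "skew_ids as ! i \<le> sum_list as"
  using nth_mem[of i "skew_ids as"] assms by (auto simp: set_skew_ids)

text \<open>
  The intervals \<open>D\<close>, \<open>B\<close> and the middle, in this order, are sent to the right end, to the left end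
  and, reversed by \<open>skew_ids as\<close>, to the place in between. Unlike the words \<open>skew_ids\<close>, this
  exchange does not reverse the order of all its intervals.
\<close>

definition exchange_word :: "nat \<Rightarrow> nat \<Rightarrow> nat list \<Rightarrow> nat list" where
  "exchange_word d b as = [b + sum_list as + 1..<Suc (b + sum_list as + d)]
     @ [1..<Suc b] @ map (\<lambda>x. x + b) (skew_ids as)"

lemma length_exchange_word [simp]: "length (exchange_word d b as) = d + b + sum_list as"
  by (simp add: exchange_word_def del: upt_Suc)

lemma set_exchange_word: "set (exchange_word d b as) = {1..length (exchange_word d b as)}"
proof -
  have "(\<lambda>x. x + b) ` {1..sum_list as} = {b + 1..b + sum_list as}"
    by (simp add: add.commute)
  then show ?thesis
    by (auto simp: exchange_word_def set_skew_ids simp del: upt_Suc image_add_atLeastAtMost')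
qed

lemma word_map_exchange:
  shows "\<lbrakk>1 \<le> i; i \<le> d\<rbrakk> \<Longrightarrow> word_map (exchange_word d b as) i = i + b + sum_list as"
    and "\<lbrakk>d < i; i \<le> d + b\<rbrakk> \<Longrightarrow> word_map (exchange_word d b as) i = i - d"
    and "\<lbrakk>d + b < i; i \<le> d + b + sum_list as\<rbrakk> \<Longrightarrow>
      word_map (exchange_word d b as) i = skew_ids as ! (i - 1 - d - b) + b"
  by (auto simp: word_map_def exchange_word_def nth_append simp del: upt_Suc)

lemma word_map_skew_ends:
  shows "\<lbrakk>1 \<le> i; i \<le> a\<rbrakk> \<Longrightarrow> word_map (skew_ids (a # as @ [b])) i = i + sum_list as + b"
    and "\<lbrakk>a < i; i \<le> a + sum_list as\<rbrakk> \<Longrightarrow>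
      word_map (skew_ids (a # as @ [b])) i = skew_ids as ! (i - 1 - a) + b"
    and "\<lbrakk>a + sum_list as < i; i \<le> a + sum_list as + b\<rbrakk> \<Longrightarrow>
      word_map (skew_ids (a # as @ [b])) i = i - a - sum_list as"
  by (auto simp: word_map_def skew_ids_Cons' skew_ids_append nth_append simp del: upt_Suc)

lemma word_map_skew_front:
  shows "\<lbrakk>1 \<le> i; i \<le> a\<rbrakk> \<Longrightarrow> word_map (skew_ids (a # b # as)) i = i + b + sum_list as"
    and "\<lbrakk>a < i; i \<le> a + b\<rbrakk> \<Longrightarrow> word_map (skew_ids (a # b # as)) i = i - a + sum_list as"
    and "\<lbrakk>a + b < i; i \<le> a + b + sum_list as\<rbrakk> \<Longrightarrow>
      word_map (skew_ids (a # b # as)) i = skew_ids as ! (i - 1 - a - b)"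
  by (auto simp: word_map_def skew_ids_Cons' nth_append simp del: upt_Suc)

text \<open>
  The first interval maps its initial \<open>d\<close> points, which make up \<open>D\<close>, to the left of the last interval,
  and its remaining \<open>b\<close> points, which make up \<open>B\<close>, onto the last interval and from there to
  \<open>{1..b}\<close>. So the return map translates \<open>B\<close> by \<open>- d\<close> and agrees with the original map elsewhere.
  Positivity of \<open>d\<close> keeps the last interval disjoint from its image.
\<close>

lemma cyclic_remove_last_block:
  assumes "0 < d"
  shows "cyclic_word (skew_ids ((d + b) # as @ [b])) \<longleftrightarrow> cyclic_word (exchange_word d b as)"
proof (rule cyclic_word_first_return[where c = 0 and e = b])
  let ?w = "skew_ids ((d + b) # as @ [b])"
  let ?X = "{1..0::nat} \<union> {0 + length (exchange_word d b as) + 1..length ?w}"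
  show "set ?w = {1..length ?w}" by (simp only: set_skew_ids length_skew_ids)
  show "exchange_word d b as \<noteq> []"
    using assms by (simp flip: length_greater_0_conv del: length_0_conv)
  show "word_map ?w x \<notin> ?X" if "x \<in> ?X" for x
    using that assms word_map_skew_ends(3)[of "d + b" as x b] by auto
  show "first_return ?X (word_map ?w) (0 + i) = 0 + word_map (exchange_word d b as) i"
    if i: "i \<in> {1..length (exchange_word d b as)}" for i
  proof -
    consider "i \<le> d" | "d < i" "i \<le> d + b" | "d + b < i" by linarith
    then show ?thesis
    proof cases
      case 1
      then show ?thesis
        using i by (simp add: first_return_def word_map_skew_ends word_map_exchange)
    next
      case 2
      then show ?thesis
        using i by (simp add: first_return_def word_map_skew_ends word_map_exchange)
    next
      case 3
      with i obtain j where j: "i = Suc (d + b + j)" "j < sum_list as"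
        using less_imp_Suc_add[of "d + b" i] by auto
      show ?thesis
        using skew_ids_nth_bounds[OF j(2)] j(2) unfolding j(1)
        by (simp add: first_return_def word_map_skew_ends word_map_exchange)
    qed
  qed
qed simp_all

section \<open>Cutting the front of the exchange\<close>

text \<open>
  The case where \<open>B\<close>, of length \<open>d + e\<close>, is at least as long as \<open>D = {1..d}\<close>, which is removed. The first
  \<open>d\<close> points of \<open>B\<close> are carried onto \<open>D\<close> and then to the right end, so they become the new \<open>D\<close>; the
  other \<open>e\<close> points form the new \<open>B\<close>.
\<close>

lemma cyclic_exchange_cut_long:
  assumes "0 < d"
  shows "cyclic_word (exchange_word d (d + e) as) \<longleftrightarrow> cyclic_word (exchange_word d e as)"
proof (rule cyclic_word_first_return[where c = d and e = 0])
  let ?w = "exchange_word d (d + e) as" and ?v = "exchange_word d e as"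
  let ?X = "{1..d} \<union> {d + length ?v + 1..length ?w}"
  show "set ?w = {1..length ?w}" by (rule set_exchange_word)
  show "?v \<noteq> []"
    using assms by (simp flip: length_greater_0_conv del: length_0_conv)
  show "word_map ?w x \<notin> ?X" if "x \<in> ?X" for x
    using that by (auto simp: word_map_exchange)
  show "first_return ?X (word_map ?w) (d + i) = d + word_map ?v i"
    if i: "i \<in> {1..length ?v}" for i
  proof -
    consider "i \<le> d" | "d < i" "i \<le> d + e" | "d + e < i" by linarith
    then show ?thesis
    proof cases
      case 3
      with i obtain j where j: "i = Suc (d + e + j)" "j < sum_list as"
        using less_imp_Suc_add[of "d + e" i] by auto
      show ?thesis
        using skew_ids_nth_bounds[OF j(2)] j(2) unfolding j(1)
        by (simp add: first_return_def word_map_exchange)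
    qed (use i in \<open>simp_all add: first_return_def word_map_exchange\<close>)
  qed
qed simp_all

text \<open>
  The case where \<open>D\<close> has length \<open>c + b\<close>, at least that of \<open>B\<close>. The interval \<open>{1..b}\<close>, which is the
  image of \<open>B\<close>, is removed, so \<open>B\<close> is carried on to the place where the first \<open>b\<close> points of \<open>D\<close>
  went. This lies just left of the image of the other \<open>c\<close> points and right of the middle, so the
  order of all intervals is now reversed.
\<close>

lemma cyclic_exchange_cut_short:
  assumes "0 < b"
  shows "cyclic_word (exchange_word (c + b) b as) \<longleftrightarrow> cyclic_word (skew_ids (c # b # as))"
proof (rule cyclic_word_first_return[where c = b and e = 0])
  let ?w = "exchange_word (c + b) b as" and ?v = "skew_ids (c # b # as)"
  let ?X = "{1..b} \<union> {b + length ?v + 1..length ?w}"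
  show "set ?w = {1..length ?w}" by (rule set_exchange_word)
  show "?v \<noteq> []"
    using assms by (simp flip: length_greater_0_conv del: length_0_conv)
  show "word_map ?w x \<notin> ?X" if "x \<in> ?X" for x
    using that by (auto simp: word_map_exchange)
  show "first_return ?X (word_map ?w) (b + i) = b + word_map ?v i"
    if i: "i \<in> {1..length ?v}" for i
  proof -
    consider "i \<le> c" | "c < i" "i \<le> c + b" | "c + b < i" by linarith
    then show ?thesis
    proof cases
      case 3
      with i obtain j where j: "i = Suc (c + b + j)" "j < sum_list as"
        using less_imp_Suc_add[of "c + b" i] by auto
      show ?thesis
        using skew_ids_nth_bounds[OF j(2)] j(2) unfolding j(1)
        by (simp add: first_return_def word_map_exchange word_map_skew_front)
    qed (use i in \<open>auto simp: first_return_def word_map_exchange word_map_skew_front\<close>)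
  qed
qed simp_all

section \<open>The reduction\<close>

lemma cyclic_word_red_comp:
  assumes pos: "\<forall>a\<in>set as. 0 < a" and len: "length as \<ge> 2" and gt: "hd as > last as"
  shows "cyclic_word (skew_ids as) \<longleftrightarrow> cyclic_word (skew_ids (red_comp as))"
proof -
  obtain a mid b where as: "as = a # mid @ [b]"
    using len by (cases as; cases "tl as" rule: rev_cases) auto
  define d where "d = a - b"
  have a: "a = d + b" and d: "0 < d" and b: "0 < b"
    using gt pos by (auto simp: as d_def)
  have step: "cyclic_word (skew_ids as) \<longleftrightarrow> cyclic_word (exchange_word d b mid)"
    unfolding as a by (rule cyclic_remove_last_block[OF d])
  show ?thesis
  proof (cases "d < b")
    case True
    \<comment> \<open>Both compositions have outer parts differing by \<open>d\<close>, and both lead to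
      \<open>exchange_word d e mid\<close>.\<close>
    define e where "e = b - d"
    have be: "b = d + e" using True by (simp add: e_def)
    have "red_comp as = (d + e) # mid @ [e]"
      using True by (simp add: red_comp_def as a be)
    then show ?thesis
      using step cyclic_exchange_cut_long[OF d, of e mid] cyclic_remove_last_block[OF d, of e mid]
      by (simp add: be)
  next
    case False
    \<comment> \<open>The case \<open>a = 2b\<close> is included: it gives \<open>c = 0\<close>, and an empty block does not change the
      word.\<close>
    define c where "c = d - b"
    have db: "d = c + b" using False by (simp add: c_def)
    have "skew_ids (red_comp as) = skew_ids (c # b # mid)"
      by (auto simp: red_comp_def as a db skew_ids_zero)
    then show ?thesis
      using step cyclic_exchange_cut_short[OF b, of c mid] by (simp add: db)
  qed
qed

lemma C_av_iff_cyclic_word: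
  assumes "\<pi> \<in> S_av n pats"
  shows "\<pi> \<in> C_av n pats \<longleftrightarrow> cyclic_word (skew_ids (kappa n \<pi>))"
proof -
  have "one_line n \<pi> = skew_ids (kappa n \<pi>)" using kappa_eq_iff[OF assms] by blast
  then show ?thesis using assms by (simp only: C_av_def cyclic_one_line mem_Collect_eq simp_thms)
qed

theorem theorem3p2:
  fixes n k :: nat and \<pi> :: "nat \<Rightarrow> nat" and as :: "nat list"
  assumes "n \<ge> 3" and "k \<ge> 2"
    and "\<pi> \<in> S_av n {[1, 3, 2], [2, 1, 3]}"
    and "kappa n \<pi> = as" and "length as = k"
    and "hd as > last as"
  shows "\<pi> \<in> C_av n {[1, 3, 2], [2, 1, 3]} \<longleftrightarrow>
         red_perm n \<pi> \<in> C_av (red_size n as) {[1, 3, 2], [2, 1, 3]}"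
proof -
  have len: "length as \<ge> 2" using assms by simp
  have pos: "\<forall>a\<in>set as. 0 < a"
    using kappa_eq_iff[OF assms(3)] assms(4) unfolding is_composition_def by blast
  have red: "red_perm n \<pi> \<in> S_av (red_size n as) pats"
    "kappa (red_size n as) (red_perm n \<pi>) = red_comp as"
    using red_perm_spec[OF assms(3)] len assms(6) unfolding assms(4) by blast+
  show ?thesis
    using C_av_iff_cyclic_word[OF assms(3)] C_av_iff_cyclic_word[OF red(1)]
      cyclic_word_red_comp[OF pos len assms(6)]
    unfolding assms(4) red(2) by blast
qed

end
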